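(* Let $(\mathcal F,d)$ be an abstract hyperbolic set whose points are labeled by the bi-infinite sequences over $\{1,2,\dots,m\}$, and let $\varphi:\mathcal F\to\mathcal F$ be its similarity map. Suppose that the diameter condition holds and that the separation condition of degree $n$ holds for some natural number $n$. Then $\varphi$ is chaotic in the sense of Devaney on each unstable set. That is, for every left-infinite sequence $\ldots i_{-2}i_{-1}i_0$ with entries in $\{1,\dots,m\}$, the unstable set $U=\mathcal F_{\ldots i_{-2}i_{-1}i_0}$ has the following properties: (i) (transitivity) there is a point $x\in U$ whose forward orbit $\{\varphi^p(x):p\ge 0\}$ is dense in $\mathcal F$; (ii) (density of periodic points) for every $x\in U$ and every $\delta>0$ there is a periodic point $y\in\mathcal F$ of $\varphi$ with $d(x,y)<\delta$; (iii) (sensitivity) there is $\varepsilon_0>0$ such that for every $x\in U$ and every $\varepsilon>0$ there exist $y\in U$ and a natural number $k$ with $d(x,y)<\varepsilon$ and $d(\varphi^k(x),\varphi^k(y))\ge\varepsilon_0$.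
   Context: Fix a natural number $m$. An abstract hyperbolic set is a metric space $(\mathcal F,d)$ whose elements are labeled by bi-infinite sequences: $$\mathcal F=\{\mathcal F_{\ldots i_{-2}i_{-1}i_0\cdot i_1i_2\ldots}: i_k\in\{1,2,\dots,m\},\ k\in\mathbb Z\},$$ where the symbol $\cdot$ marks the position between the index $i_0$ and the index $i_1$. Similarity map: $\varphi:\mathcal F\to\mathcal F$ is the (well-defined) one-to-one and onto map given by $$\varphi(\mathcal F_{\ldots i_{-1}i_0\cdot i_1i_2i_3\ldots})=\mathcal F_{\ldots i_{-1}i_0i_1\cdot i_2i_3\ldots}.$$ Unstable sets: for a left-infinite sequence $\ldots i_{-2}i_{-1}i_0$, the unstable set (of any point whose label has this left part) is $$\mathcal F_{\ldots i_{-2}i_{-1}i_0}=\{\mathcal F_{\ldots i_{-2}i_{-1}i_0\cdot j_1j_2\ldots}: j_k\in\{1,\dots,m\},\ k=1,2,\dots\}.$$ Cylinder subsets: $\mathcal F_{i_{-k}i_{-k+1}\ldots i_0\cdot i_1i_2\ldots i_n}$ is the set of all points of $\mathcal F$ whose labels have the prescribed entries $i_{-k},\dots,i_0,i_1,\dots,i_n$ at positions $-k,\dots,n$, all other entries being arbitrary. $\mathcal F_{i_1i_2\ldots i_n}$ is the set of all points of $\mathcal F$ whose labels have the prescribed entries $i_1,\dots,i_n$ at positions $1,\dots,n$, all other entries (at positions $\le 0$ and $>n$) being arbitrary. Diameter condition: for every bi-infinite sequence $\ldots i_{-1}i_0\cdot i_1i_2\ldots$ with entries in $\{1,\dots,m\}$,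 $$\mathrm{diam}(\mathcal F_{i_{-k}\ldots i_0\cdot i_1\ldots i_n})\to 0\quad\text{as } k,n\to\infty,$$ where $\mathrm{diam}(A)=\sup\{d(x,y):x,y\in A\}$. Separation condition of degree $n$: there exist $\varepsilon_0>0$ and a natural number $n$ such that for arbitrary indices $i_1,\dots,i_n\in\{1,\dots,m\}$ one can find indices $j_1,\dots,j_n\in\{1,\dots,m\}$ with $$d(\mathcal F_{i_1i_2\ldots i_n},\mathcal F_{j_1j_2\ldots j_n})\ge\varepsilon_0,$$ where $d(A,B)=\inf\{d(x,y):x\in A,\ y\in B\}$. Periodic points: a point of $\mathcal F$ is periodic with period $q$ if its label consists of endless (bi-infinite) repetition of a block of $q$ terms. *)

theory Defs
  imports "HOL-Analysis.Analysis"
begin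

text \<open>
  Throughout, \<open>pt s\<close> is the point labelled by the bi-infinite sequence \<open>s\<close>; position \<open>k\<close> of the
  label is \<open>s k\<close>, so the mark between \<open>i\<^sub>0\<close> and \<open>i\<^sub>1\<close> sits between \<open>s 0\<close> and \<open>s 1\<close>.
\<close>

definition label_seqs :: "nat \<Rightarrow> (int \<Rightarrow> nat) set" where
  "label_seqs m = {s. \<forall>k. s k \<in> {1..m}}"

text \<open>Labels are not assumed to be unique: the labelling \<open>pt\<close> need not be injective.\<close>

locale abstract_hyperbolic_set = Metric_space F d
  for F :: "'a set" and d :: "'a \<Rightarrow> 'a \<Rightarrow> real" +
  fixes m :: nat and pt :: "(int \<Rightarrow> nat) \<Rightarrow> 'a"
  assumes m_pos: "1 \<le> m"
    and points_eq: "F = pt ` label_seqs m"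

text \<open>
  As labels may be non-unique, the existence of \<open>\<phi>\<close> expresses that the shift of labels is
  well defined on points.
\<close>

definition similarity_map ::
  "'a set \<Rightarrow> nat \<Rightarrow> ((int \<Rightarrow> nat) \<Rightarrow> 'a) \<Rightarrow> ('a \<Rightarrow> 'a) \<Rightarrow> bool" where
  "similarity_map F m pt \<phi> \<longleftrightarrow>
     bij_betw \<phi> F F \<and> (\<forall>s\<in>label_seqs m. \<phi> (pt s) = pt (\<lambda>k. s (k + 1)))"

text \<open>A left-infinite sequence is given by the values of \<open>a\<close> at positions \<open>\<le> 0\<close> only.\<close>

definition unstable_set :: "nat \<Rightarrow> ((int \<Rightarrow> nat) \<Rightarrow> 'a) \<Rightarrow> (int \<Rightarrow> nat) \<Rightarrow> 'a set" where
  "unstable_set m pt a = pt ` {s \<in> label_seqs m. \<forall>k\<le>0. s k = a k}"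

text \<open>
  The entries at positions \<open>l, \<dots>, r\<close> are prescribed by \<open>w\<close>. The set indexed by
  \<open>i\<^sub>-\<^sub>k \<dots> i\<^sub>0 \<cdot> i\<^sub>1 \<dots> i\<^sub>n\<close> has \<open>l = -k\<close>, \<open>r = n\<close>; the one indexed by \<open>i\<^sub>1 \<dots> i\<^sub>n\<close> has \<open>l = 1\<close>, \<open>r = n\<close>.
\<close>

definition cylinder ::
  "nat \<Rightarrow> ((int \<Rightarrow> nat) \<Rightarrow> 'a) \<Rightarrow> int \<Rightarrow> int \<Rightarrow> (int \<Rightarrow> nat) \<Rightarrow> 'a set" where
  "cylinder m pt l r w = pt ` {s \<in> label_seqs m. \<forall>k\<in>{l..r}. s k = w k}"

text \<open>
  The supremum is taken in \<^typ>\<open>ennreal\<close>, so that unbounded sets have infinite diameter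
  (a real-valued supremum would be unspecified there).
\<close>

definition set_diam :: "('a \<Rightarrow> 'a \<Rightarrow> real) \<Rightarrow> 'a set \<Rightarrow> ennreal" where
  "set_diam d A = (SUP (x, y)\<in>A \<times> A. ennreal (d x y))"

text \<open>Meant for nonempty sets only, which cylinders are.\<close>

definition set_distance :: "('a \<Rightarrow> 'a \<Rightarrow> real) \<Rightarrow> 'a set \<Rightarrow> 'a set \<Rightarrow> real" where
  "set_distance d A B = (INF (x, y)\<in>A \<times> B. d x y)"

definition diameter_condition ::
  "('a \<Rightarrow> 'a \<Rightarrow> real) \<Rightarrow> nat \<Rightarrow> ((int \<Rightarrow> nat) \<Rightarrow> 'a) \<Rightarrow> bool" where
  "diameter_condition d m pt \<longleftrightarrow>
     (\<forall>s\<in>label_seqs m.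
        ((\<lambda>(k, n). set_diam d (cylinder m pt (- int k) (int n) s)) \<longlongrightarrow> 0)
          (sequentially \<times>\<^sub>F sequentially))"

definition separation_condition ::
  "('a \<Rightarrow> 'a \<Rightarrow> real) \<Rightarrow> nat \<Rightarrow> ((int \<Rightarrow> nat) \<Rightarrow> 'a) \<Rightarrow> nat \<Rightarrow> bool" where
  "separation_condition d m pt n \<longleftrightarrow>
     1 \<le> n \<and>
     (\<exists>\<epsilon>\<^sub>0>0. \<forall>i. (\<forall>k\<in>{1..int n}. i k \<in> {1..m}) \<longrightarrow>
        (\<exists>j. (\<forall>k\<in>{1..int n}. j k \<in> {1..m}) \<and>
             \<epsilon>\<^sub>0 \<le> set_distance d (cylinder m pt 1 (int n) i) (cylinder m pt 1 (int n) j)))"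

text \<open>The bi-infinite repetition of the block \<open>w\<close>, with a copy of \<open>w\<close> starting at position \<open>1\<close>.\<close>

definition repeat_block :: "nat list \<Rightarrow> int \<Rightarrow> nat" where
  "repeat_block w k = w ! nat ((k - 1) mod int (length w))"

definition periodic_point :: "nat \<Rightarrow> ((int \<Rightarrow> nat) \<Rightarrow> 'a) \<Rightarrow> nat \<Rightarrow> 'a \<Rightarrow> bool" where
  "periodic_point m pt q x \<longleftrightarrow>
     1 \<le> q \<and> (\<exists>w. length w = q \<and> set w \<subseteq> {1..m} \<and> x = pt (repeat_block w))"

end

theory Submission imports Defs "HOL-Library.Nat_Bijection" begin

text \<open>
  By the diameter condition, labels that agree with \<open>s\<close> on a long enough window \<open>{-N..N}\<close> name points
  close to \<open>pt s\<close>. Keeping the left half \<open>a\<close> of a label and writing all finite words one after another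
  on the right half gives a dense orbit; repeating the window of a label periodically gives a nearby
  periodic point; and replacing the \<open>n\<close> entries right after the window by those from the separation
  condition gives a nearby point of the same unstable set that is separated after \<open>N\<close> shifts.
\<close>

lemma length_le_list_encode: "length xs \<le> list_encode xs"
proof (induction xs)
  case (Cons x xs)
  then show ?case
    using le_prod_encode_2[of "list_encode xs" x] by simp
qed simp

text \<open>
  \<^const>\<open>prod_encode\<close> fills the diagonals \<open>{(i, j). i + j = c}\<close> one by one; the \<open>c\<close>-th diagonal carries
  the word with code \<open>c\<close>, which fits since its length is at most \<open>c\<close>.
\<close>

lemma ex_sequence_containing_all_words:
  fixes A :: "nat set"
  assumes "A \<noteq> {}"
  obtains u :: "nat \<Rightarrow> nat"
  where "\<And>k. u k \<in> A"
    and "\<And>w. set w \<subseteq> A \<Longrightarrow> \<exists>p. \<forall>i<length w. u (p + i) = w ! i"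
proof -
  obtain b where b: "b \<in> A" using assms by blast
  \<comment> \<open>With \<open>prod_decode k = (i, j)\<close>, the value is letter \<open>i\<close>
    of the word with code \<open>i + j\<close>. The default \<open>b\<close> fills the cells past
    the end of that word and replaces letters outside \<open>A\<close>.\<close>
  define u where "u = (\<lambda>k. case prod_decode k of (i, j) \<Rightarrow>
    let w = list_decode (i + j) in if i < length w \<and> w ! i \<in> A then w ! i else b)"
  show thesis
  proof
    show "u k \<in> A" for k
      using b by (auto simp: u_def Let_def split: prod.split)
    show "\<exists>p. \<forall>i<length w. u (p + i) = w ! i" if w: "set w \<subseteq> A" for w
    proof (intro exI allI impI)
      fix i assume i: "i < length w"
      have "i \<le> list_encode w" using i length_le_list_encode[of w] by simp
      then have "triangle (list_encode w) + i = prod_encode (i, list_encode w - i)"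
        by (simp add: prod_encode_def)
      moreover have "w ! i \<in> A" using w i nth_mem by blast
      ultimately show "u (triangle (list_encode w) + i) = w ! i"
        using i \<open>i \<le> list_encode w\<close> by (simp add: u_def Let_def)
    qed
  qed
qed

lemma label_seqs_shift: "s \<in> label_seqs m \<Longrightarrow> (\<lambda>k. s (k + c)) \<in> label_seqs m"
  by (simp add: label_seqs_def)

lemma similarity_map_funpow:
  assumes "similarity_map F m pt \<phi>" "s \<in> label_seqs m"
  shows "(\<phi> ^^ p) (pt s) = pt (\<lambda>k. s (k + int p))"
proof (induction p)
  case (Suc p)
  then show ?case
    using assms label_seqs_shift[OF assms(2), of "int p"]
    by (simp add: similarity_map_def ac_simps)
qed simp

lemma dist_le_set_diam:
  "x \<in> A \<Longrightarrow> y \<in> A \<Longrightarrow> ennreal (d x y) \<le> set_diam d A"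
  unfolding set_diam_def by (rule SUP_upper2[of "(x, y)"]) auto

lemma (in Metric_space) set_distance_le_dist:
  assumes "x \<in> A" "y \<in> B"
  shows "set_distance d A B \<le> d x y"
proof -
  have "bdd_below ((\<lambda>(x, y). d x y) ` (A \<times> B))"
    by (rule bdd_belowI[of _ 0]) auto
  then show ?thesis
    unfolding set_distance_def using assms
    by (intro cINF_lower2[of _ _ "(x, y)"]) auto
qed

text \<open>Convergence along the product filter yields one threshold for both ends of the cylinder,
  hence a symmetric window. The bound \<open>1 \<le> N\<close> serves sensitivity, where
  \<open>N\<close> becomes the number of iterations.\<close>

lemma diameter_condition_window:
  assumes "diameter_condition d m pt" "s \<in> label_seqs m" "0 < (e::real)"
  obtains N where "1 \<le> N"
    "\<And>t. t \<in> label_seqs m \<Longrightarrow> \<forall>k\<in>{-int N..int N}. t k = s k \<Longrightarrow> d (pt s) (pt t) < e"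
proof -
  have "\<forall>\<^sub>F (k, n) in sequentially \<times>\<^sub>F sequentially.
      set_diam d (cylinder m pt (- int k) (int n) s) < ennreal e"
    using order_tendstoD(2)[of _ 0 _ "ennreal e"] assms
    by (fastforce simp: diameter_condition_def case_prod_unfold)
  then obtain M where M: "\<And>k n. M \<le> k \<Longrightarrow> M \<le> n \<Longrightarrow>
      set_diam d (cylinder m pt (- int k) (int n) s) < ennreal e"
    unfolding eventually_prod_sequentially by fastforce
  show thesis
  proof
    \<comment> \<open>The witness is \<open>Suc M\<close> rather than \<open>M\<close>, which makes
      it positive.\<close>
    fix t assume t: "t \<in> label_seqs m" "\<forall>k\<in>{-int (Suc M)..int (Suc M)}. t k = s k"
    have "ennreal (d (pt s) (pt t)) \<le> set_diam d (cylinder m pt (- int (Suc M)) (int (Suc M)) s)"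
      using t assms(2) by (intro dist_le_set_diam) (auto simp: cylinder_def)
    also have "\<dots> < ennreal e" by (rule M) auto
    finally show "d (pt s) (pt t) < e"
      using assms(3) by (metis ennreal_leI leD not_le)
  qed simp
qed

context abstract_hyperbolic_set
begin

lemma pt_in: "s \<in> label_seqs m \<Longrightarrow> pt s \<in> F"
  using points_eq by blast

lemma unstable_set_dense_orbit:
  assumes "similarity_map F m pt \<phi>" "diameter_condition d m pt"
    and a: "\<forall>k\<le>0. a k \<in> {1..m}"
  shows "\<exists>x\<in>unstable_set m pt a. mtopology closure_of {(\<phi> ^^ p) x | p. p \<ge> 0} = F"
proof -
  have "{1..m} \<noteq> {}" using m_pos by simp
  then obtain u where u: "\<And>k. u k \<in> {1..m}"
      "\<And>w. set w \<subseteq> {1..m} \<Longrightarrow> \<exists>p. \<forall>i<length w. u (p + i) = w ! i"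
    using ex_sequence_containing_all_words[of "{1..m}"] by blast
  \<comment> \<open>The left half \<open>a\<close> puts \<open>pt t\<close> into the unstable set;
    \<open>u k\<close> sits at position \<open>k + 1\<close>.\<close>
  define t where "t k = (if k \<le> 0 then a k else u (nat (k - 1)))" for k
  have t: "t \<in> label_seqs m"
    using u(1) a by (simp add: label_seqs_def t_def)
  have orbit: "(\<phi> ^^ p) (pt t) = pt (\<lambda>k. t (k + int p))" for p
    by (rule similarity_map_funpow[OF assms(1) t])
  have "\<exists>p. (\<phi> ^^ p) (pt t) \<in> mball y r" if y: "y \<in> F" and r: "0 < r" for y r
  proof -
    obtain s where s: "s \<in> label_seqs m" "y = pt s" using y points_eq by blast
    obtain N where N: "\<And>t. t \<in> label_seqs m \<Longrightarrow>
        \<forall>k\<in>{-int N..int N}. t k = s k \<Longrightarrow> d (pt s) (pt t) < r"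
      using diameter_condition_window[OF assms(2) s(1) r] by blast
    define w where "w = map (\<lambda>i. s (int i - int N)) [0..<2 * N + 1]"
    have "set w \<subseteq> {1..m}" using s(1) by (auto simp: w_def label_seqs_def)
    then obtain p where p: "\<And>i. i < 2 * N + 1 \<Longrightarrow> u (p + i) = s (int i - int N)"
      using u(2)[of w] by (auto simp: w_def simp del: upt_Suc)
    \<comment> \<open>The copy of \<open>w\<close> found in \<open>u\<close> occupies positions
      \<open>p + 1\<close> to \<open>p + 2 * N + 1\<close> of \<open>t\<close>; shifting by
      \<open>P\<close> carries it to \<open>-N\<close> to \<open>N\<close>.\<close>
    define P where "P = p + N + 1"
    have "t (k + int P) = s k" if "k \<in> {-int N..int N}" for k
    proof -
      have "nat (k + int P - 1) = p + nat (k + int N)" "\<not> k + int P \<le> 0"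
        "nat (k + int N) < 2 * N + 1"
        using that by (auto simp: P_def)
      then show ?thesis using that p[of "nat (k + int N)"] by (simp add: t_def)
    qed
    then have "d (pt s) (pt (\<lambda>k. t (k + int P))) < r"
      using N[OF label_seqs_shift[OF t]] by blast
    then have "(\<phi> ^^ P) (pt t) \<in> mball y r"
      using s y pt_in[OF label_seqs_shift[OF t]] by (simp add: orbit)
    then show ?thesis by blast
  qed
  then have "mtopology closure_of {(\<phi> ^^ p) (pt t) | p. p \<ge> 0} = F"
    unfolding metric_closure_of by blast
  moreover have "pt t \<in> unstable_set m pt a"
    using t by (auto simp: unstable_set_def t_def)
  ultimately show ?thesis by blast
qed

lemma periodic_points_dense:
  assumes "diameter_condition d m pt" "x \<in> F" "0 < \<delta>"
  shows "\<exists>y\<in>F. (\<exists>q. periodic_point m pt q y) \<and> d x y < \<delta>"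
proof -
  obtain s where s: "s \<in> label_seqs m" "x = pt s" using assms(2) points_eq by blast
  obtain N where N: "\<And>t. t \<in> label_seqs m \<Longrightarrow>
      \<forall>k\<in>{-int N..int N}. t k = s k \<Longrightarrow> d (pt s) (pt t) < \<delta>"
    using diameter_condition_window[OF assms(1) s(1) assms(3)] by blast
  define q where "q = 2 * N + 1"
  \<comment> \<open>\<open>repeat_block\<close> starts a copy of its block at position 1, so the
    window of \<open>s\<close> has to be rotated: entry \<open>j\<close> is the value of
    \<open>s\<close> at the representative of \<open>j + 1\<close> modulo \<open>q\<close> between
    \<open>-N\<close> and \<open>N\<close>.\<close>
  define w where "w = map (\<lambda>j. s ((int j + 1 + int N) mod int q - int N)) [0..<q]"
  have w: "length w = q" "set w \<subseteq> {1..m}"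
    using s(1) by (auto simp: w_def label_seqs_def)
  have rep: "repeat_block w k = s ((k + int N) mod int q - int N)" for k
  proof -
    have "nat ((k - 1) mod int q) < q" by (simp add: q_def nat_less_iff)
    then have "repeat_block w k =
        s (((k - 1) mod int q + (1 + int N)) mod int q - int N)"
      by (simp add: repeat_block_def w_def q_def ac_simps del: upt_Suc)
    then show ?thesis by (simp only: mod_add_left_eq) (simp add: algebra_simps)
  qed
  \<comment> \<open>On the window \<open>k + N\<close> lies between 0 and \<open>q - 1\<close>, so
    the reduction modulo \<open>q\<close> changes nothing.\<close>
  have "repeat_block w k = s k" if "k \<in> {-int N..int N}" for k
    using that by (simp add: rep q_def)
  moreover have label: "repeat_block w \<in> label_seqs m"
    using s(1) by (simp add: rep label_seqs_def)
  ultimately have "d x (pt (repeat_block w)) < \<delta>" using N s(2) by blast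
  moreover have "periodic_point m pt q (pt (repeat_block w))"
    using w by (auto simp: periodic_point_def q_def)
  ultimately show ?thesis using pt_in[OF label] by blast
qed

text \<open>The separation constant itself serves as \<open>\<epsilon>\<^sub>0\<close>, which makes
  it uniform in \<open>x\<close> and \<open>\<epsilon>\<close>.\<close>

lemma unstable_set_sensitivity:
  assumes "similarity_map F m pt \<phi>" "diameter_condition d m pt" "separation_condition d m pt n"
  shows "\<exists>\<epsilon>\<^sub>0>0. \<forall>x\<in>unstable_set m pt a. \<forall>\<epsilon>>0.
    \<exists>y\<in>unstable_set m pt a. \<exists>k\<ge>1. d x y < \<epsilon> \<and> d ((\<phi> ^^ k) x) ((\<phi> ^^ k) y) \<ge> \<epsilon>\<^sub>0"
proof -
  obtain \<epsilon>\<^sub>0 where "\<epsilon>\<^sub>0 > 0" and sep: "\<And>i. \<forall>k\<in>{1..int n}. i k \<in> {1..m} \<Longrightarrow>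
      \<exists>j. (\<forall>k\<in>{1..int n}. j k \<in> {1..m}) \<and>
        \<epsilon>\<^sub>0 \<le> set_distance d (cylinder m pt 1 (int n) i) (cylinder m pt 1 (int n) j)"
    using assms(3) unfolding separation_condition_def by blast
  have "\<exists>y\<in>unstable_set m pt a. \<exists>k\<ge>1. d x y < \<epsilon> \<and> d ((\<phi> ^^ k) x) ((\<phi> ^^ k) y) \<ge> \<epsilon>\<^sub>0"
    if x: "x \<in> unstable_set m pt a" and "\<epsilon> > 0" for x \<epsilon>
  proof -
    obtain s where s: "s \<in> label_seqs m" "\<forall>k\<le>0. s k = a k" "x = pt s"
      using x by (auto simp: unstable_set_def)
    obtain N where "1 \<le> N" and N: "\<And>t. t \<in> label_seqs m \<Longrightarrow>
        \<forall>k\<in>{-int N..int N}. t k = s k \<Longrightarrow> d (pt s) (pt t) < \<epsilon>"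
      using diameter_condition_window[OF assms(2) s(1) \<open>\<epsilon> > 0\<close>] by blast
    \<comment> \<open>This is a label of \<open>(\<phi> ^^ N) x\<close>; its entries at 1 to
      \<open>n\<close> form the word handed to the separation condition.\<close>
    define i where "i k = s (k + int N)" for k
    have "\<forall>k\<in>{1..int n}. i k \<in> {1..m}" using s(1) by (simp add: i_def label_seqs_def)
    then obtain j where j: "\<forall>k\<in>{1..int n}. j k \<in> {1..m}"
        "\<epsilon>\<^sub>0 \<le> set_distance d (cylinder m pt 1 (int n) i) (cylinder m pt 1 (int n) j)"
      using sep by blast
    \<comment> \<open>Changes are confined to positions \<open>N + 1\<close> to
      \<open>N + n\<close>: beyond the window, so \<open>pt t\<close> stays close to
      \<open>x\<close>, and to the right of 0, so it stays in the unstable set.\<close>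
    define t where "t k = (if k - int N \<in> {1..int n} then j (k - int N) else s k)" for k
    have t: "t \<in> label_seqs m"
      using s(1) j(1) unfolding label_seqs_def t_def by auto
    have "d x (pt t) < \<epsilon>" unfolding s(3) by (rule N[OF t]) (simp add: t_def)
    moreover have "pt t \<in> unstable_set m pt a"
      unfolding unstable_set_def using t s(2) by (auto simp: t_def)
    \<comment> \<open>After \<open>N\<close> shifts the altered stretch sits at 1 to
      \<open>n\<close>, so the two images lie in the two separated cylinders.\<close>
    moreover have "(\<phi> ^^ N) x \<in> cylinder m pt 1 (int n) i"
      unfolding s(3) similarity_map_funpow[OF assms(1) s(1)] cylinder_def
      using label_seqs_shift[OF s(1)] by (intro imageI) (simp add: i_def)
    moreover have "(\<phi> ^^ N) (pt t) \<in> cylinder m pt 1 (int n) j"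
      unfolding similarity_map_funpow[OF assms(1) t] cylinder_def
      using label_seqs_shift[OF t, of "int N"] by (intro imageI) (simp add: t_def)
    ultimately show ?thesis
      using j(2) set_distance_le_dist \<open>1 \<le> N\<close> by (meson order_trans)
  qed
  then show ?thesis using \<open>\<epsilon>\<^sub>0 > 0\<close> by blast
qed

end

theorem theorem1:
  fixes F :: "'a set" and d :: "'a \<Rightarrow> 'a \<Rightarrow> real" and m n :: nat
    and pt :: "(int \<Rightarrow> nat) \<Rightarrow> 'a" and \<phi> :: "'a \<Rightarrow> 'a"
  assumes "abstract_hyperbolic_set F d m pt"
    and "similarity_map F m pt \<phi>"
    and "diameter_condition d m pt"
    and "separation_condition d m pt n"
  shows "\<forall>a :: int \<Rightarrow> nat. (\<forall>k\<le>0. a k \<in> {1..m}) \<longrightarrow>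
    (\<exists>x\<in>unstable_set m pt a.
       Metric_space.mtopology F d closure_of {(\<phi> ^^ p) x | p. p \<ge> 0} = F) \<and>
    (\<forall>x\<in>unstable_set m pt a. \<forall>\<delta>>0.
       \<exists>y\<in>F. (\<exists>q. periodic_point m pt q y) \<and> d x y < \<delta>) \<and>
    (\<exists>\<epsilon>\<^sub>0>0. \<forall>x\<in>unstable_set m pt a. \<forall>\<epsilon>>0.
       \<exists>y\<in>unstable_set m pt a. \<exists>k\<ge>1. d x y < \<epsilon> \<and> d ((\<phi> ^^ k) x) ((\<phi> ^^ k) y) \<ge> \<epsilon>\<^sub>0)"
proof -
  interpret abstract_hyperbolic_set F d m pt by (rule assms(1))
  \<comment> \<open>Periodic points are shown to approximate every point of \<open>F\<close>; this
    inclusion passes to the unstable set.\<close>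
  have "unstable_set m pt a \<subseteq> F" for a
    unfolding unstable_set_def using pt_in by blast
  then show ?thesis
    using unstable_set_dense_orbit[OF assms(2,3)] periodic_points_dense[OF assms(3)]
      unstable_set_sensitivity[OF assms(2-4)]
    by (meson subsetD)
qed

end
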